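(* Let $f:\mathbb{R}^d\to\mathbb{R}$ be a differentiable function with unique minimizer $x^\star$ which is convex, $L$-smooth for some $L>0$, and satisfies the $\alpha$-quadratic growth condition $f(x)\ge f(x^\star)+\frac{\alpha}{2}\|x-x^\star\|^2$ for all $x\in\mathbb{R}^d$, for some $\alpha>0$; let $\kappa=L/\alpha$. Let $\varepsilon>0$ and $x_0\in\mathbb{R}^d$, and set $$K=\left\lceil4\log\frac{f(x_0)-f(x^\star)}{\varepsilon}\right\rceil,\qquad N_k=\left\lceil\frac{5}{2}\sqrt\kappa\right\rceil\quad\text{for all }k\in\{1,\dots,K\},$$ where $K$ is a positive integer (as the algorithm requires). Then the output $x_K$ of the algorithm dHFA-eg run from $x_0$ for $K$ iterations with parameter $\lambda=0$, step size $\eta=\frac{1}{\sqrt L}$ and discretization steps $N_1,\dots,N_K$ satisfies $f(x_K)-f(x^\star)\le\varepsilon$, and the total number of gradient evaluations is $$N_{\mathrm{tot}}=2\cdot\left\lceil\frac{5}{2}\sqrt\kappa\right\rceil\cdot\left\lceil4\log\frac{f(x_0)-f(x^\star)}{\varepsilon}\right\rceil.$$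
   Context: $f$ is $L$-smooth if $f(x')\le f(x)+\langle\nabla f(x),x'-x\rangle+\frac{L}{2}\|x'-x\|^2$ for all $x,x'\in\mathbb{R}^d$. $\log$ is the natural logarithm. The extragradient integrator with step size $\eta>0$ started at $(x_0,y_0)\in\mathbb{R}^{2d}$ generates, for $n\ge0$, $x_{n+1/2}=x_n+\eta y_n$, $x_{n+1}=x_{n+1/2}-\eta^2\nabla f(x_{n+1/2})$, $y_{n+1}=y_n-\eta\nabla f(x_{n+1})$. Each step counts as 2 gradient evaluations, so the total number of gradient evaluations of the algorithm below is $N_{\mathrm{tot}}=2\sum_{k=1}^KN_k$. Algorithm dHFA-eg. Input: $x_0\in\mathbb{R}^d$, number of iterations $K\in\mathbb{N}$, parameter $\lambda\ge0$, step size $\eta>0$, discretization steps $N_1,\dots,N_K\in\mathbb{N}$ (positive integers). For $k=1,\dots,K$: generate $(x^{(k)}_n,y^{(k)}_n)_{n=1}^{N_k}$ with the extragradient integrator with step size $\eta$ started at $(x^{(k)}_0,y^{(k)}_0)=(x_{k-1},\mathbf{0})$; compute $x^{\mathrm{avg}}(x_{k-1};N_k)=\frac{2}{N_k(N_k+1)}\sum_{n=1}^{N_k}(N_k-n+1)x^{(k)}_n$; set $x_k=\frac{1}{\lambda+1}x^{\mathrm{avg}}(x_{k-1};N_k)+\frac{\lambda}{\lambda+1}x^{(k)}_{N_k}$. Output: $x_K$. *)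

theory Defs
  imports "HOL-Analysis.Analysis"
begin

definition grad :: "('a::real_inner \<Rightarrow> real) \<Rightarrow> 'a \<Rightarrow> 'a" where
  "grad f x = (THE D. GDERIV f x :> D)"

lemma GDERIV_grad:
  fixes f :: "'a::euclidean_space \<Rightarrow> real"
  assumes "f differentiable (at x)"
  shows "GDERIV f x :> grad f x"
proof -
  obtain F where F: "(f has_derivative F) (at x)"
    using assms unfolding differentiable_def by blast
  interpret F: bounded_linear F
    using F by (rule has_derivative_bounded_linear)
  define D where "D = (\<Sum>b\<in>Basis. F b *\<^sub>R b)"
  have FD: "F = (\<lambda>h. h \<bullet> D)"
  proof
    fix h
    have "F h = F (\<Sum>b\<in>Basis. (h \<bullet> b) *\<^sub>R b)"
      by (simp add: euclidean_representation)
    also have "\<dots> = (\<Sum>b\<in>Basis. (h \<bullet> b) * F b)"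
      by (simp add: F.sum F.scaleR)
    also have "\<dots> = h \<bullet> D"
      by (simp add: D_def inner_sum_right mult.commute)
    finally show "F h = h \<bullet> D" .
  qed
  have D: "GDERIV f x :> D"
    using F unfolding gderiv_def FD by simp
  have "E = D" if "GDERIV f x :> E" for E
  proof -
    have "(\<lambda>h. h \<bullet> E) = (\<lambda>h. h \<bullet> D)"
      using that D unfolding gderiv_def by (rule has_derivative_unique)
    then have "\<forall>h. h \<bullet> E = h \<bullet> D" by (simp add: fun_eq_iff)
    then show ?thesis using vector_eq_rdot[of E D] by (simp add: inner_commute)
  qed
  with D show ?thesis
    unfolding grad_def by (rule theI)
qed

definition L_smooth :: "real \<Rightarrow> ('a::real_inner \<Rightarrow> real) \<Rightarrow> bool" where
  "L_smooth L f \<longleftrightarrow>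
     (\<forall>x x'. f x' \<le> f x + grad f x \<bullet> (x' - x) + L / 2 * (norm (x' - x))\<^sup>2)"

definition unique_minimizer :: "('a \<Rightarrow> real) \<Rightarrow> 'a \<Rightarrow> bool" where
  "unique_minimizer f xs \<longleftrightarrow> (\<forall>z. is_arg_min f (\<lambda>_. True) z \<longleftrightarrow> z = xs)"

definition quadratic_growth :: "real \<Rightarrow> ('a::real_inner \<Rightarrow> real) \<Rightarrow> 'a \<Rightarrow> bool" where
  "quadratic_growth \<alpha> f xs \<longleftrightarrow> (\<forall>x. f x \<ge> f xs + \<alpha> / 2 * (norm (x - xs))\<^sup>2)"

definition eg_step :: "('a::real_inner \<Rightarrow> real) \<Rightarrow> real \<Rightarrow> 'a \<times> 'a \<Rightarrow> 'a \<times> 'a" where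
  "eg_step f \<eta> = (\<lambda>(x, y).
     let xh = x + \<eta> *\<^sub>R y;
         x' = xh - \<eta>\<^sup>2 *\<^sub>R grad f xh;
         y' = y - \<eta> *\<^sub>R grad f x'
     in (x', y'))"

primrec eg :: "('a::real_inner \<Rightarrow> real) \<Rightarrow> real \<Rightarrow> 'a \<times> 'a \<Rightarrow> nat \<Rightarrow> 'a \<times> 'a" where
  "eg f \<eta> xy 0 = xy"
| "eg f \<eta> xy (Suc n) = eg_step f \<eta> (eg f \<eta> xy n)"

text \<open>Position iterates of the integrator started at \<open>x\<close> with zero velocity.\<close>

definition eg_pos :: "('a::real_inner \<Rightarrow> real) \<Rightarrow> real \<Rightarrow> 'a \<Rightarrow> nat \<Rightarrow> 'a" where
  "eg_pos f \<eta> x n = fst (eg f \<eta> (x, 0) n)"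

definition x_avg :: "('a::real_inner \<Rightarrow> real) \<Rightarrow> real \<Rightarrow> 'a \<Rightarrow> nat \<Rightarrow> 'a" where
  "x_avg f \<eta> x N =
     (2 / (real N * (real N + 1))) *\<^sub>R
       (\<Sum>n = 1..N. (real N - real n + 1) *\<^sub>R eg_pos f \<eta> x n)"

text \<open>The outer iterates \<open>x\<^sub>k\<close>. The numbers of inner steps are \<open>N 1\<close>, \<open>N 2\<close>, and so on;
  \<open>N 0\<close> is never used.\<close>

primrec dHFA_eg ::
  "('a::real_inner \<Rightarrow> real) \<Rightarrow> real \<Rightarrow> real \<Rightarrow> (nat \<Rightarrow> nat) \<Rightarrow> 'a \<Rightarrow> nat \<Rightarrow> 'a" where
  "dHFA_eg f lam \<eta> N x0 0 = x0"
| "dHFA_eg f lam \<eta> N x0 (Suc k) =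
     (let x = dHFA_eg f lam \<eta> N x0 k; M = N (Suc k)
      in (1 / (lam + 1)) *\<^sub>R x_avg f \<eta> x M + (lam / (lam + 1)) *\<^sub>R eg_pos f \<eta> x M)"

text \<open>Each integrator step evaluates the gradient twice.\<close>

definition N_tot :: "(nat \<Rightarrow> nat) \<Rightarrow> nat \<Rightarrow> nat" where
  "N_tot N K = 2 * (\<Sum>k = 1..K. N k)"

end

theory Submission
  imports Defs
begin

text \<open>The integrator discretizes the Hamiltonian flow \<open>x' = y\<close>, \<open>y' = - grad f x\<close>, and the proof
  is best understood for this flow, started at rest in \<open>x\<^sub>0\<close>. Let \<open>w\<close> be the minimizer,
  \<open>\<phi> = f x - f w\<close> and \<open>\<phi>\<^sub>0\<close> the initial value of \<open>\<phi>\<close>. Energy conservation gives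
  \<open>\<bar>y\<bar>\<^sup>2 = 2 (\<phi>\<^sub>0 - \<phi>)\<close>, and convexity gives \<open>grad f x \<bullet> (x - w) \<ge> \<phi>\<close>. So the second derivative of
  \<open>\<bar>x - w\<bar>\<^sup>2 / 2\<close>, which is \<open>\<bar>y\<bar>\<^sup>2 - grad f x \<bullet> (x - w)\<close>, is at most \<open>2 \<phi>\<^sub>0 - 3 \<phi>\<close>. Integrating
  twice up to time \<open>T\<close> weights \<open>\<phi>\<close> at time \<open>t\<close> by \<open>T - t\<close>, the continuous form of the triangular
  weights in \<open>x_avg\<close>. As \<open>\<bar>x - w\<bar>\<^sup>2\<close> stays nonnegative, the weighted average of \<open>\<phi>\<close> is at most
  \<open>2/3 \<phi>\<^sub>0 + \<bar>x\<^sub>0 - w\<bar>\<^sup>2 / (3 T\<^sup>2)\<close>, and by Jensen's inequality so is \<open>\<phi>\<close> at the averaged point.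

  The discrete proof follows the same path with \<open>T\<^sup>2\<close> replaced by \<open>\<eta>\<^sup>2 M (M + 1)\<close>. Energy is no
  longer conserved but still does not increase (\<open>energy_step\<close>). The first differences of
  \<open>\<bar>x - w\<bar>\<^sup>2 / 2\<close> and of \<open>y \<bullet> (x - w)\<close> obey one-step bounds (\<open>dist_step\<close>, \<open>cross_step\<close>),
  whose discretization errors telescope (\<open>cross_le\<close>) and are absorbed by the surplus of \<open>M (M + 1)\<close>
  over the weights that the kinetic terms really carry (\<open>dist_growth_le\<close>). No constant is lost,
  and \<open>x_avg_gap_le\<close> has exactly the continuous form.

  Quadratic growth turns \<open>\<bar>x\<^sub>0 - w\<bar>\<^sup>2\<close> into \<open>2 \<phi>\<^sub>0 / \<alpha>\<close>. With \<open>\<eta>\<^sup>2 = 1 / L\<close> and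
  \<open>M \<ge> 5/2 \<surd>\<kappa>\<close> one run therefore contracts the gap by the factor
  \<open>2/3 + 8/75 = 58/75 \<le> exp (- 1/4)\<close>, and \<open>4 log (\<phi>\<^sub>0 / \<epsilon>)\<close> runs reach accuracy \<open>\<epsilon>\<close>.\<close>

section \<open>Convex smooth functions\<close>

locale convex_smooth =
  fixes f :: "'a::euclidean_space \<Rightarrow> real" and L :: real
  assumes differentiable: "f differentiable (at x)"
    and convex: "convex_on UNIV f"
    and L_pos: "L > 0"
    and smooth: "L_smooth L f"
begin

lemma descent: "f b \<le> f a + grad f a \<bullet> (b - a) + L / 2 * (norm (b - a))\<^sup>2"
  using smooth by (auto simp: L_smooth_def)

lemma gradient_step_decreases:
  assumes "0 \<le> s" and "L * s \<le> 1"
  shows "f (a - s *\<^sub>R grad f a) \<le> f a - s / 2 * (norm (grad f a))\<^sup>2"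
proof -
  have "f (a - s *\<^sub>R grad f a) \<le> f a - s * (norm (grad f a))\<^sup>2 + L / 2 * (s\<^sup>2 * (norm (grad f a))\<^sup>2)"
    using descent[of "a - s *\<^sub>R grad f a" a]
    by (simp add: dot_square_norm power_mult_distrib)
  moreover have "(L * s) * (s * (norm (grad f a))\<^sup>2) \<le> 1 * (s * (norm (grad f a))\<^sup>2)"
    using assms by (intro mult_right_mono) auto
  ultimately show ?thesis by (simp add: power2_eq_square algebra_simps)
qed

lemma above_tangent: "f a + grad f a \<bullet> (b - a) \<le> f b"
proof -
  define g where "g t = f (a + t *\<^sub>R (b - a))" for t :: real
  have "convex_on UNIV g"
  proof (rule convex_onI)
    fix t u v :: real assume t: "0 < t" "t < 1"
    have "a + ((1 - t) * u + t * v) *\<^sub>R (b - a)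
        = (1 - t) *\<^sub>R (a + u *\<^sub>R (b - a)) + t *\<^sub>R (a + v *\<^sub>R (b - a))"
      by (simp add: algebra_simps)
    then show "g ((1 - t) *\<^sub>R u + t *\<^sub>R v) \<le> (1 - t) * g u + t * g v"
      using convex_onD[OF convex, of t "a + u *\<^sub>R (b - a)" "a + v *\<^sub>R (b - a)"] t
      by (simp add: g_def)
  qed simp
  moreover have "(g has_real_derivative grad f a \<bullet> (b - a)) (at 0)"
  proof -
    have "(f has_derivative (\<lambda>h. h \<bullet> grad f a)) (at (a + 0 *\<^sub>R (b - a)))"
      using GDERIV_grad[OF differentiable, of a] by (simp add: gderiv_def)
    moreover have "((\<lambda>t. a + t *\<^sub>R (b - a)) has_derivative (\<lambda>t. t *\<^sub>R (b - a))) (at 0)"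
      by (auto intro!: derivative_eq_intros)
    ultimately have "(g has_derivative (\<lambda>t. (t *\<^sub>R (b - a)) \<bullet> grad f a)) (at 0)"
      unfolding g_def by (rule has_derivative_compose[rotated])
    moreover have "(\<lambda>t. (t *\<^sub>R (b - a)) \<bullet> grad f a) = (*) (grad f a \<bullet> (b - a))"
      by (simp add: fun_eq_iff inner_commute)
    ultimately show ?thesis
      by (simp add: has_field_derivative_def)
  qed
  ultimately have "g 1 - g 0 \<ge> grad f a \<bullet> (b - a) * (1 - 0)"
    by (intro convex_on_imp_above_tangent[where A = UNIV]) (auto simp: convex_connected)
  then show ?thesis by (simp add: g_def)
qed

text \<open>Smoothness sharpens the tangent inequality: the gap between \<open>f\<close> and its tangent at \<open>a\<close>
  is again convex and smooth and minimal at \<open>a\<close>, and a gradient step from \<open>b\<close> on this gap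
  cannot lead below zero.\<close>

lemma above_tangent_strong:
  "f a + grad f a \<bullet> (b - a) + (norm (grad f b - grad f a))\<^sup>2 / (2 * L) \<le> f b"
proof -
  define d where "d = grad f b - grad f a"
  define c where "c = b - (1 / L) *\<^sub>R d"
  define q where "q = (norm d)\<^sup>2 / L"
  have "f a + grad f a \<bullet> (c - a) \<le> f c" by (rule above_tangent)
  also have "f c \<le> f b + grad f b \<bullet> (c - b) + L / 2 * (norm (c - b))\<^sup>2" by (rule descent)
  finally have "f a + grad f a \<bullet> (b - a) \<le> f b + d \<bullet> (c - b) + L / 2 * (norm (c - b))\<^sup>2"
    by (simp add: d_def inner_diff algebra_simps)
  moreover have "d \<bullet> (c - b) = - q"
    by (simp add: c_def q_def power2_norm_eq_inner)
  moreover have "L / 2 * (norm (c - b))\<^sup>2 = q / 2"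
    using L_pos by (simp add: c_def q_def power_divide power2_eq_square)
  moreover have "(norm d)\<^sup>2 / (2 * L) = q / 2" by (simp add: q_def)
  ultimately show ?thesis
    unfolding d_def[symmetric] by linarith
qed

lemma grad_lipschitz: "norm (grad f b - grad f a) \<le> L * norm (b - a)"
proof -
  let ?d = "grad f b - grad f a"
  have "(norm ?d)\<^sup>2 / L \<le> ?d \<bullet> (b - a)"
    using above_tangent_strong[of a b] above_tangent_strong[of b a]
    by (simp add: norm_minus_commute inner_diff field_simps)
  also have "\<dots> \<le> norm ?d * norm (b - a)" by (rule norm_cauchy_schwarz)
  finally have "norm ?d * norm ?d \<le> norm ?d * (L * norm (b - a))"
    using L_pos by (simp add: power2_eq_square field_simps)
  then show ?thesis
    by (cases "?d = 0") (use L_pos in auto)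
qed

end

section \<open>One run of the extragradient integrator\<close>

locale eg_run = convex_smooth f L
  for f :: "'a::euclidean_space \<Rightarrow> real" and L :: real +
  fixes \<eta> :: real and start w :: 'a
  assumes \<eta>_pos: "\<eta> > 0"
    and step_size: "L * \<eta>\<^sup>2 \<le> 1"
begin

abbreviation "X \<equiv> eg_pos f \<eta> start"
definition "Y n = snd (eg f \<eta> (start, 0) n)"
definition "P n = X n + \<eta> *\<^sub>R Y n"
definition "gap n = f (X n) - f w"

lemma X_0: "X 0 = start" and Y_0: "Y 0 = 0"
  by (simp_all add: eg_pos_def Y_def)

lemma X_Suc: "X (Suc n) = P n - \<eta>\<^sup>2 *\<^sub>R grad f (P n)"
  by (simp add: eg_pos_def P_def Y_def eg_step_def split_def Let_def)

lemma X_Suc_diff: "X (Suc n) - X n = \<eta> *\<^sub>R (Y n - \<eta> *\<^sub>R grad f (P n))"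
  by (simp add: X_Suc P_def algebra_simps power2_eq_square)

lemma Y_Suc: "Y (Suc n) = Y n - \<eta> *\<^sub>R grad f (X (Suc n))"
  by (simp add: eg_pos_def Y_def eg_step_def split_def Let_def)

text \<open>Let \<open>g\<close> and \<open>h\<close> be the gradients at \<open>P n\<close> and \<open>X (Suc n)\<close>. Were \<open>h\<close> used in place of \<open>g\<close>, the
  step would be implicit Euler, which dissipates energy for convex \<open>f\<close>. For the integrator,
  convexity still bounds the energy change by \<open>\<eta>\<^sup>2 / 2 * (\<bar>h - g\<bar>\<^sup>2 - \<bar>g\<bar>\<^sup>2)\<close>. This is not positive:
  the two points differ by \<open>\<eta>\<^sup>2 g\<close>, and \<open>L * \<eta>\<^sup>2 \<le> 1\<close>.\<close>

lemma energy_step: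
  "gap (Suc n) + (norm (Y (Suc n)))\<^sup>2 / 2 \<le> gap n + (norm (Y n))\<^sup>2 / 2"
proof -
  let ?g = "grad f (P n)" and ?h = "grad f (X (Suc n))"
  have "norm (?h - ?g) \<le> L * (\<eta>\<^sup>2 * norm ?g)"
    using grad_lipschitz[of "X (Suc n)" "P n"] by (simp add: X_Suc)
  also have "\<dots> \<le> norm ?g"
    using mult_right_mono[OF step_size norm_ge_zero[of ?g]] by (simp add: mult.assoc)
  finally have "(norm (?h - ?g))\<^sup>2 \<le> (norm ?g)\<^sup>2"
    by (simp add: power_mono)
  then have "\<eta>\<^sup>2 * ((norm (?h - ?g))\<^sup>2 - (norm ?g)\<^sup>2) \<le> 0"
    by (simp add: mult_nonneg_nonpos)
  moreover have "gap (Suc n) - gap n \<le> ?h \<bullet> (X (Suc n) - X n)"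
    using above_tangent[of "X (Suc n)" "X n"] by (simp add: gap_def inner_diff_right)
  moreover have "?h \<bullet> (X (Suc n) - X n) = \<eta> * (?h \<bullet> Y n) - \<eta>\<^sup>2 * (?h \<bullet> ?g)"
    by (simp add: X_Suc_diff inner_diff_right power2_eq_square algebra_simps)
  moreover have "(norm (Y (Suc n)))\<^sup>2 = (norm (Y n))\<^sup>2 - 2 * \<eta> * (?h \<bullet> Y n) + \<eta>\<^sup>2 * (norm ?h)\<^sup>2"
    unfolding Y_Suc power2_norm_eq_inner
    by (simp add: inner_diff inner_commute power2_eq_square algebra_simps)
  moreover have "(norm (?h - ?g))\<^sup>2 = (norm ?h)\<^sup>2 - 2 * (?h \<bullet> ?g) + (norm ?g)\<^sup>2"
    by (simp add: power2_norm_eq_inner inner_diff inner_commute algebra_simps)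
  ultimately show ?thesis by (simp add: algebra_simps)
qed

lemma energy_le: "gap n + (norm (Y n))\<^sup>2 / 2 \<le> gap 0"
  by (induction n) (use energy_step order_trans in \<open>auto simp: Y_0\<close>)

lemma gap_le: "gap n \<le> gap 0"
  using energy_le[of n] zero_le_power2[of "norm (Y n)"] by linarith

lemma gap_Suc_le: "gap (Suc n) \<le> f (P n) - f w - \<eta>\<^sup>2 / 2 * (norm (grad f (P n)))\<^sup>2"
  using gradient_step_decreases[of "\<eta>\<^sup>2" "P n"] step_size by (simp add: gap_def X_Suc)

text \<open>Expanding the gradient step from \<open>P n\<close> leaves its squared length with the wrong sign. The
  decrease of \<open>f\<close> along this same step, weighted by \<open>\<eta>\<^sup>2\<close>, pays for it exactly.\<close>

lemma dist_step:
  "(norm (X (Suc n) - w))\<^sup>2 / 2 - (norm (X n - w))\<^sup>2 / 2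
     \<le> \<eta> * (Y n \<bullet> (X n - w)) + \<eta>\<^sup>2 * ((norm (Y n))\<^sup>2 / 2 - gap (Suc n))"
proof -
  let ?g = "grad f (P n)"
  have "f (P n) - f w \<le> ?g \<bullet> (P n - w)"
    using above_tangent[of "P n" w] by (simp add: inner_diff_right)
  then have "gap (Suc n) + \<eta>\<^sup>2 / 2 * (norm ?g)\<^sup>2 \<le> ?g \<bullet> (P n - w)"
    using gap_Suc_le[of n] by linarith
  then have "\<eta>\<^sup>2 * (gap (Suc n) + \<eta>\<^sup>2 / 2 * (norm ?g)\<^sup>2 - ?g \<bullet> (P n - w)) \<le> 0"
    by (simp add: mult_nonneg_nonpos)
  moreover have "(norm (X (Suc n) - w))\<^sup>2
      = (norm (P n - w))\<^sup>2 - 2 * \<eta>\<^sup>2 * (?g \<bullet> (P n - w)) + \<eta>\<^sup>2 * \<eta>\<^sup>2 * (norm ?g)\<^sup>2"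
    unfolding X_Suc
    by (simp add: power2_norm_eq_inner inner_diff inner_commute algebra_simps)
  moreover have "(norm (P n - w))\<^sup>2
      = (norm (X n - w))\<^sup>2 + 2 * \<eta> * (Y n \<bullet> (X n - w)) + \<eta>\<^sup>2 * (norm (Y n))\<^sup>2"
    unfolding P_def power2_norm_eq_inner
    by (simp add: inner_diff inner_add inner_commute
        power2_eq_square algebra_simps)
  ultimately show ?thesis by (simp add: algebra_simps)
qed

text \<open>Discrete form of the derivative \<open>\<bar>y\<bar>\<^sup>2 - grad f x \<bullet> (x - w)\<close> of \<open>y \<bullet> (x - w)\<close>. The additional
  term \<open>\<eta> * (Y n \<bullet> grad f (P n))\<close> is an error of the discretization.\<close>

lemma cross_step:
  "Y (Suc n) \<bullet> (X (Suc n) - w) - Y n \<bullet> (X n - w)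
     \<le> \<eta> * ((norm (Y n))\<^sup>2 - \<eta> * (Y n \<bullet> grad f (P n)) - gap (Suc n))"
proof -
  let ?g = "grad f (P n)" and ?h = "grad f (X (Suc n))"
  have "gap (Suc n) \<le> ?h \<bullet> (X (Suc n) - w)"
    using above_tangent[of "X (Suc n)" w] by (simp add: gap_def inner_diff_right)
  then have "\<eta> * gap (Suc n) \<le> \<eta> * (?h \<bullet> (X (Suc n) - w))"
    using \<eta>_pos by simp
  moreover have "Y (Suc n) \<bullet> (X (Suc n) - w) - Y n \<bullet> (X n - w)
      = Y n \<bullet> (X (Suc n) - X n) - \<eta> * (?h \<bullet> (X (Suc n) - w))"
    by (simp add: Y_Suc inner_diff algebra_simps)
  moreover have "Y n \<bullet> (X (Suc n) - X n) = \<eta> * ((norm (Y n))\<^sup>2 - \<eta> * (Y n \<bullet> ?g))"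
    by (simp add: X_Suc_diff inner_diff_right power2_norm_eq_inner)
  ultimately show ?thesis by (simp add: algebra_simps)
qed

text \<open>The discretization error is at most the decrease of the gap in the same step, so that its sum
  telescopes.\<close>

lemma slope_le: "- \<eta> * (Y n \<bullet> grad f (P n)) \<le> gap n - gap (Suc n)"
proof -
  have "- \<eta> * (Y n \<bullet> grad f (P n)) \<le> f (X n) - f (P n)"
    using above_tangent[of "P n" "X n"] by (simp add: P_def inner_commute)
  moreover have "0 \<le> \<eta>\<^sup>2 / 2 * (norm (grad f (P n)))\<^sup>2" by simp
  ultimately show ?thesis using gap_Suc_le[of n] unfolding gap_def by linarith
qed

text \<open>By \<open>energy_le\<close> and \<open>slope_le\<close>, one step adds at most
  \<open>\<eta> * (2 * gap 0 - gap n - 2 * gap (Suc n))\<close>. The three gaps belong to two different times;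
  collecting them at one time leaves the boundary terms \<open>gap 1\<close> and \<open>gap (Suc m)\<close>. The kinetic
  energy contributes \<open>m\<close> and not \<open>Suc m\<close> times, because \<open>Y 0 = 0\<close>.\<close>

lemma cross_le:
  "Y (Suc m) \<bullet> (X (Suc m) - w)
     \<le> \<eta> * (2 * real m * gap 0 - 3 * (\<Sum>n = 1..Suc m. gap n) + gap 1 + gap (Suc m))"
proof (induction m)
  case 0
  then show ?case using cross_step[of 0] by (simp add: Y_0)
next
  case (Suc m)
  let ?n = "Suc m"
  have "(norm (Y ?n))\<^sup>2 - \<eta> * (Y ?n \<bullet> grad f (P ?n)) - gap (Suc ?n)
      \<le> 2 * gap 0 - gap ?n - 2 * gap (Suc ?n)"
    using slope_le[of ?n] energy_le[of ?n] by simp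
  then have "\<eta> * ((norm (Y ?n))\<^sup>2 - \<eta> * (Y ?n \<bullet> grad f (P ?n)) - gap (Suc ?n))
      \<le> \<eta> * (2 * gap 0 - gap ?n - 2 * gap (Suc ?n))"
    using \<eta>_pos by simp
  then show ?case
    using Suc.IH cross_step[of ?n] by (simp add: algebra_simps)
qed

text \<open>For \<open>m > 0\<close> the bounds so far contain \<open>2 * real m - 1\<close> times \<open>gap 0\<close>, three copies
  fewer than the right-hand side. These three pay for \<open>gap 1\<close> and for the two copies of \<open>gap (Suc m)\<close>
  that the sum asks for in addition, since no gap exceeds \<open>gap 0\<close>.\<close>

lemma dist_growth_le:
  "(norm (X (Suc m) - w))\<^sup>2 / 2 - (norm (X m - w))\<^sup>2 / 2
     \<le> \<eta>\<^sup>2 * (2 * real (Suc m) * gap 0 - 3 * (\<Sum>n = 1..Suc m. gap n))"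
proof (cases m)
  case 0
  have "\<eta>\<^sup>2 * gap 1 \<le> \<eta>\<^sup>2 * gap 0"
    using gap_le by (simp add: mult_left_mono)
  then show ?thesis using dist_step[of 0] 0 by (simp add: Y_0 algebra_simps)
next
  case (Suc k)
  have "\<eta> * (Y m \<bullet> (X m - w))
      \<le> \<eta> * (\<eta> * (2 * real k * gap 0 - 3 * (\<Sum>n = 1..m. gap n) + gap 1 + gap m))"
    using cross_le[of k] \<eta>_pos Suc by simp
  then have "(norm (X (Suc m) - w))\<^sup>2 / 2 - (norm (X m - w))\<^sup>2 / 2
      \<le> \<eta>\<^sup>2 * ((2 * real k * gap 0 - 3 * (\<Sum>n = 1..m. gap n) + gap 1 + gap m)
          + ((norm (Y m))\<^sup>2 / 2 - gap (Suc m)))"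
    using dist_step[of m] by (simp add: power2_eq_square algebra_simps)
  also have "\<dots> \<le> \<eta>\<^sup>2 * (2 * real (Suc m) * gap 0 - 3 * (\<Sum>n = 1..Suc m. gap n))"
    using energy_le[of m] gap_le[of 1] gap_le[of "Suc m"] Suc
    by (intro mult_left_mono) (simp_all add: algebra_simps)
  finally show ?thesis .
qed

lemma dist_le:
  "(norm (X M - w))\<^sup>2 / 2
     \<le> (norm (start - w))\<^sup>2 / 2
       + \<eta>\<^sup>2 * (real M * (real M + 1) * gap 0 - 3 * (\<Sum>n = 1..M. (real M - real n + 1) * gap n))"
proof (induction M)
  case 0
  then show ?case by (simp add: X_0)
next
  case (Suc M)
  \<comment> \<open>The triangular weights are what remains of a double sum: raising \<open>M\<close> raises each weight by one.\<close>
  have "(\<Sum>n = 1..Suc M. (real (Suc M) - real n + 1) * gap n)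
      = (\<Sum>n = 1..Suc M. (real M - real n + 1) * gap n) + (\<Sum>n = 1..Suc M. gap n)"
    by (simp add: sum.distrib[symmetric] algebra_simps del: sum.cl_ivl_Suc)
  also have "(\<Sum>n = 1..Suc M. (real M - real n + 1) * gap n)
      = (\<Sum>n = 1..M. (real M - real n + 1) * gap n)" by simp
  finally have weights: "(\<Sum>n = 1..Suc M. (real (Suc M) - real n + 1) * gap n)
      = (\<Sum>n = 1..M. (real M - real n + 1) * gap n) + (\<Sum>n = 1..Suc M. gap n)" .
  show ?case
    using Suc.IH dist_growth_le[of M] unfolding weights
    by (simp add: algebra_simps del: sum.cl_ivl_Suc)
qed

lemma sum_weights: "(\<Sum>n = 1..M. real M - real n + 1) = real M * (real M + 1) / 2"
proof (induction M)
  case (Suc M)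
  have "(\<Sum>n = 1..Suc M. real (Suc M) - real n + 1) = (\<Sum>n = 1..M. real M - real n + 1) + real (Suc M)"
    by (simp add: sum.distrib)
  then show ?case using Suc.IH by (simp add: field_simps)
qed simp

theorem x_avg_gap_le:
  assumes "M > 0"
  shows "f (x_avg f \<eta> start M) - f w
    \<le> 2 / 3 * (f start - f w) + (norm (start - w))\<^sup>2 / (3 * \<eta>\<^sup>2 * (real M * (real M + 1)))"
proof -
  define W where "W = real M * (real M + 1)"
  define c where "c n = 2 / W * (real M - real n + 1)" for n
  define S where "S = (\<Sum>n = 1..M. (real M - real n + 1) * gap n)"
  have W: "W > 0" using assms by (simp add: W_def)
  have c1: "(\<Sum>n = 1..M. c n) = 1"
    using W unfolding c_def sum_distrib_left[symmetric] sum_weights W_def[symmetric] by simp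
  have "x_avg f \<eta> start M = (\<Sum>n = 1..M. c n *\<^sub>R X n)"
    by (simp add: x_avg_def c_def W_def scaleR_right.sum)
  moreover have "f (\<Sum>n = 1..M. c n *\<^sub>R X n) \<le> (\<Sum>n = 1..M. c n * f (X n))"
    using W by (intro convex_on_sum[OF _ _ convex c1]) (use assms in \<open>auto simp: c_def\<close>)
  moreover have "(\<Sum>n = 1..M. c n * f (X n)) - f w = (\<Sum>n = 1..M. c n * gap n)"
    using c1 by (simp add: gap_def right_diff_distrib sum_subtractf sum_distrib_right[symmetric])
  moreover have "(\<Sum>n = 1..M. c n * gap n) = 2 / W * S"
    unfolding c_def S_def sum_distrib_left by (simp only: mult.assoc)
  ultimately have avg: "f (x_avg f \<eta> start M) - f w \<le> 2 / W * S" by simp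
  have "0 \<le> (norm (X M - w))\<^sup>2 / 2" by simp
  also have "\<dots> \<le> (norm (start - w))\<^sup>2 / 2 + \<eta>\<^sup>2 * (W * gap 0 - 3 * S)"
    using dist_le[of M] by (simp add: W_def S_def)
  finally have "2 / W * S \<le> 2 / 3 * gap 0 + (norm (start - w))\<^sup>2 / (3 * \<eta>\<^sup>2 * W)"
    using W \<eta>_pos by (simp add: field_simps)
  with avg show ?thesis by (simp add: gap_def X_0 W_def)
qed

end

section \<open>Restarting\<close>

text \<open>The margin is narrow: \<open>exp x \<ge> 1 + x\<close> becomes sharp enough only near zero, so it is applied
  at an eighth of the exponent.\<close>

lemma exp_quarter_bound: "58 / 75 \<le> exp (- 1 / 4 :: real)"
proof -
  have "(31 / 32 :: real) ^ 8 \<le> exp (- 1 / 32) ^ 8"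
    using exp_ge_add_one_self[of "- 1 / 32 :: real"] by (intro power_mono) simp_all
  also have "\<dots> = exp (- 1 / 4)" by (simp add: exp_of_nat_mult[symmetric])
  finally show ?thesis by (simp add: power_divide)
qed

text \<open>Quadratic growth bounds the distance term of \<open>x_avg_gap_le\<close> by \<open>2 * L / \<alpha> / (3 * M\<^sup>2)\<close> times
  the initial gap, and the choice of \<open>M\<close> makes this factor at most \<open>8 / 75\<close>.\<close>

lemma x_avg_contraction:
  fixes f :: "'a::euclidean_space \<Rightarrow> real"
  assumes "convex_smooth f L" and "\<alpha> > 0" and growth: "quadratic_growth \<alpha> f w"
    and M: "real M \<ge> 5 / 2 * sqrt (L / \<alpha>)"
  shows "f (x_avg f (1 / sqrt L) x M) - f w \<le> exp (- 1 / 4) * (f x - f w)"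
proof -
  interpret convex_smooth f L by fact
  have grow: "f w + \<alpha> / 2 * (norm (z - w))\<^sup>2 \<le> f z" for z
    using growth by (simp add: quadratic_growth_def)
  have min: "f w \<le> f z" for z
    using grow[of z] zero_le_power2[of "norm (z - w)"] \<open>\<alpha> > 0\<close>
    by (smt (verit) mult_nonneg_nonneg divide_pos_pos)
  interpret eg_run f L "1 / sqrt L" x w
    by unfold_locales (use L_pos in \<open>auto simp: power_divide\<close>)
  have "M > 0"
    using M L_pos \<open>\<alpha> > 0\<close> by (smt (verit) divide_pos_pos of_nat_0_less_iff real_sqrt_gt_zero mult_pos_pos)
  have "(5 / 2 * sqrt (L / \<alpha>))\<^sup>2 \<le> (real M)\<^sup>2"
    using M L_pos \<open>\<alpha> > 0\<close> by (intro power_mono) auto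
  then have "25 / 4 * (L / \<alpha>) \<le> (real M)\<^sup>2"
    using L_pos \<open>\<alpha> > 0\<close> by (simp add: power_mult_distrib power_divide)
  also have "\<dots> \<le> real M * (real M + 1)" by (simp add: power2_eq_square algebra_simps)
  finally have W: "25 * L \<le> 4 * \<alpha> * (real M * (real M + 1))"
    using \<open>\<alpha> > 0\<close> by (simp add: field_simps)
  have W_pos: "0 < real M * (real M + 1)" using \<open>M > 0\<close> by simp
  have "(norm (x - w))\<^sup>2 \<le> 2 / \<alpha> * (f x - f w)"
    using grow[of x] \<open>\<alpha> > 0\<close> by (simp add: field_simps)
  then have "L * (norm (x - w))\<^sup>2 \<le> L * (2 / \<alpha> * (f x - f w))"
    using L_pos by (intro mult_left_mono) auto
  also have "\<dots> = (25 * L) * (2 / (25 * \<alpha>) * (f x - f w))" by simp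
  also have "\<dots> \<le> (4 * \<alpha> * (real M * (real M + 1))) * (2 / (25 * \<alpha>) * (f x - f w))"
    using W min[of x] \<open>\<alpha> > 0\<close> by (intro mult_right_mono) auto
  also have "\<dots> = 8 / 25 * (f x - f w) * (real M * (real M + 1))"
    using \<open>\<alpha> > 0\<close> by simp
  finally have "L * (norm (x - w))\<^sup>2 / (3 * (real M * (real M + 1))) \<le> 8 / 75 * (f x - f w)"
    using W_pos by (simp add: field_simps)
  moreover have "(norm (x - w))\<^sup>2 / (3 * (1 / sqrt L)\<^sup>2 * (real M * (real M + 1)))
      = L * (norm (x - w))\<^sup>2 / (3 * (real M * (real M + 1)))"
    using L_pos by (simp add: power_divide)
  ultimately have "f (x_avg f (1 / sqrt L) x M) - f w \<le> 58 / 75 * (f x - f w)"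
    using x_avg_gap_le[OF \<open>M > 0\<close>] by linarith
  also have "\<dots> \<le> exp (- 1 / 4) * (f x - f w)"
    using exp_quarter_bound min[of x] by (intro mult_right_mono) simp_all
  finally show ?thesis .
qed

theorem corollary4:
  fixes f :: "real ^ 'd \<Rightarrow> real"
    and xs x0 :: "real ^ 'd"
    and L \<alpha> \<kappa> \<epsilon> :: real
    and K :: nat
    and N :: "nat \<Rightarrow> nat"
  assumes "\<And>x. f differentiable (at x)"
    and "unique_minimizer f xs"
    and "convex_on UNIV f"
    and "L > 0" and "L_smooth L f"
    and "\<alpha> > 0" and "quadratic_growth \<alpha> f xs"
    and "\<kappa> = L / \<alpha>"
    and "\<epsilon> > 0"
    and "int K = \<lceil>4 * ln ((f x0 - f xs) / \<epsilon>)\<rceil>" and "K > 0"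
    and "\<And>k. k \<in> {1..K} \<Longrightarrow> int (N k) = \<lceil>5 / 2 * sqrt \<kappa>\<rceil>"
  shows "f (dHFA_eg f 0 (1 / sqrt L) N x0 K) - f xs \<le> \<epsilon> \<and>
    int (N_tot N K) = 2 * \<lceil>5 / 2 * sqrt \<kappa>\<rceil> * \<lceil>4 * ln ((f x0 - f xs) / \<epsilon>)\<rceil>"
proof
  have cs: "convex_smooth f L"
    using assms(1,3-5) by unfold_locales
  let ?z = "dHFA_eg f 0 (1 / sqrt L) N x0"
  have gap: "f (?z k) - f xs \<le> exp (- 1 / 4) ^ k * (f x0 - f xs)" if "k \<le> K" for k
    using that
  proof (induction k)
    case (Suc k)
    have "int (N (Suc k)) = \<lceil>5 / 2 * sqrt \<kappa>\<rceil>" using assms(12) Suc.prems by simp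
    then have "real (N (Suc k)) \<ge> 5 / 2 * sqrt (L / \<alpha>)"
      using le_of_int_ceiling[of "5 / 2 * sqrt \<kappa>"] assms(8) by (metis of_int_of_nat_eq)
    then have "f (x_avg f (1 / sqrt L) (?z k) (N (Suc k))) - f xs \<le> exp (- 1 / 4) * (f (?z k) - f xs)"
      by (rule x_avg_contraction[OF cs assms(6,7)])
    also have "\<dots> \<le> exp (- 1 / 4) * (exp (- 1 / 4) ^ k * (f x0 - f xs))"
      using Suc by (intro mult_left_mono) simp_all
    finally show ?case by (simp add: Let_def mult.assoc)
  qed simp
  \<comment> \<open>Since \<open>ln 0 = 0\<close>, a start at the minimizer would make \<open>K\<close> zero.\<close>
  have "f x0 \<noteq> f xs" using assms(10,11) by auto
  moreover have "is_arg_min f (\<lambda>_. True) xs"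
    using assms(2) by (simp add: unique_minimizer_def)
  then have "f xs \<le> f x0" by (simp add: is_arg_min_linorder)
  ultimately have pos: "0 < (f x0 - f xs) / \<epsilon>" using \<open>\<epsilon> > 0\<close> by simp
  have "ln ((f x0 - f xs) / \<epsilon>) \<le> real K / 4" using assms(10) by linarith
  then have "exp (ln ((f x0 - f xs) / \<epsilon>)) \<le> exp (real K / 4)" by simp
  then have "(f x0 - f xs) / \<epsilon> \<le> exp (real K / 4)" using pos by simp
  then have "f x0 - f xs \<le> \<epsilon> * exp (real K / 4)" using \<open>\<epsilon> > 0\<close> by (simp add: field_simps)
  then have "exp (- 1 / 4) ^ K * (f x0 - f xs) \<le> exp (- (real K / 4)) * (\<epsilon> * exp (real K / 4))"
    by (simp add: exp_of_nat_mult[symmetric])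
  also have "\<dots> = \<epsilon>" by (simp add: exp_minus)
  finally show "f (?z K) - f xs \<le> \<epsilon>" using gap[of K] by simp
  have "int (N_tot N K) = 2 * (\<Sum>k = 1..K. int (N k))" by (simp add: N_tot_def)
  also have "\<dots> = 2 * (\<Sum>k = 1..K. \<lceil>5 / 2 * sqrt \<kappa>\<rceil>)"
    using assms(12) by (intro arg_cong[where f = "(*) 2"] sum.cong) auto
  also have "\<dots> = 2 * \<lceil>5 / 2 * sqrt \<kappa>\<rceil> * \<lceil>4 * ln ((f x0 - f xs) / \<epsilon>)\<rceil>"
    using assms(10) by simp
  finally show "int (N_tot N K) = 2 * \<lceil>5 / 2 * sqrt \<kappa>\<rceil> * \<lceil>4 * ln ((f x0 - f xs) / \<epsilon>)\<rceil>" .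
qed

end
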